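(* Let $\mu,\delta>0$ and put $L_{\mathrm d}=\frac1\mu$. For each $y\in\mathbb{R}^m$ let $u_\mu(y)\in U$ be an approximate solution of the inner problem $\min_{u\in U}\mathcal{L}^{\mathrm{ag}}_\mu(u,y)$ satisfying $$0\le \mathcal{L}^{\mathrm{ag}}_{\mu}(u_{\mu}(y),y)-d^{\mathrm{ag}}_{\mu}(y)\le\delta .$$ Then for all $x,y\in\mathbb{R}^m$, $$0\le \mathcal{L}^{\mathrm{ag}}_{\mu}(u_{\mu}(y),y)+\langle\nabla_x\mathcal{L}^{\mathrm{ag}}_{\mu}(u_{\mu}(y),y),x-y\rangle-d^{\mathrm{ag}}_{\mu}(x)\le\frac{2L_{\mathrm d}}{2}\|x-y\|^2+3\delta ,$$ i.e. the augmented dual function $d^{\mathrm{ag}}_\mu$ is equipped with a first order inexact $(3\delta,2L_{\mathrm d})$-oracle.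
   Context: Setting. Consider $f^*=\min_{u\in U} f(u)$ s.t. $Gu+g\in\mathcal{K}$, where $f:\mathbb{R}^n\to\mathbb{R}\cup\{+\infty\}$ is proper, closed and convex, $U\subseteq\mathrm{dom} f$ is nonempty, closed, convex and bounded, $G\in\mathbb{R}^{m\times n}$, $g\in\mathbb{R}^m$, and $\mathcal{K}\subseteq\mathbb{R}^m$ is a nonempty closed convex cone with polar cone $\mathcal{K}^*=\{v:\langle v,\kappa\rangle\le0\ \forall\kappa\in\mathcal{K}\}$. It is assumed that there is a Lagrange multiplier $x^*\in\mathcal{K}^*$ closing the duality gap, i.e. $f^*=d(x^* )$, where $d(x)=\min_{u\in U,s\in\mathcal{K}}f(u)+\langle x,Gu+g-s\rangle$. Norms are Euclidean, $[v]_{\mathcal{K}}$ is the Euclidean projection of $v$ onto $\mathcal{K}$ and $\mathrm{dist}_{\mathcal{K}}(v)=\|v-[v]_{\mathcal{K}}\|$. Augmented Lagrangian: $\mathcal{L}^{\mathrm{ag}}_\mu(u,x)=f(u)+\frac\mu2\,\mathrm{dist}_{\mathcal{K}}\left(Gu+g+\frac1\mu x\right)^2-\frac1{2\mu}\|x\|^2$. Augmented dual function: $d^{\mathrm{ag}}_\mu(x)=\min_{u\in U}\mathcal{L}^{\mathrm{ag}}_\mu(u,x)$. The partial gradient in $x$ is $\nabla_x\mathcal{L}^{\mathrm{ag}}_\mu(u,x)=Gu+g-\left[Gu+g+\frac1\mu x\right]_{\mathcal{K}}$. *)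

theory Defs
  imports "HOL-Analysis.Analysis"
begin

text \<open>
  Convexity and closedness of an extended-real-valued function are convexity and closedness of its
  epigraph, which is a subset of \<open>'a \<times> real\<close> also when the function takes infinite values. The
  library constants \<^const>\<open>epigraph\<close> and \<^const>\<open>convex_on\<close> cover real-valued functions only.
\<close>

definition ereal_epigraph :: "('a \<Rightarrow> ereal) \<Rightarrow> ('a \<times> real) set" where
  "ereal_epigraph f = {(u, t). f u \<le> ereal t}"

definition convex_fun :: "('a::real_vector \<Rightarrow> ereal) \<Rightarrow> bool" where
  "convex_fun f \<longleftrightarrow> convex (ereal_epigraph f)"

definition closed_fun :: "('a::topological_space \<Rightarrow> ereal) \<Rightarrow> bool" where
  "closed_fun f \<longleftrightarrow> closed (ereal_epigraph f)"

definition edom :: "('a \<Rightarrow> ereal) \<Rightarrow> 'a set" where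
  "edom f = {u. f u < \<infinity>}"

definition proper_fun :: "('a \<Rightarrow> ereal) \<Rightarrow> bool" where
  "proper_fun f \<longleftrightarrow> (\<forall>u. f u \<noteq> -\<infinity>) \<and> edom f \<noteq> {}"

definition polar_cone :: "'a::real_inner set \<Rightarrow> 'a set" where
  "polar_cone K = {v. \<forall>k\<in>K. inner v k \<le> 0}"

definition dist_proj :: "'a::euclidean_space set \<Rightarrow> 'a \<Rightarrow> real" where
  "dist_proj K v = norm (v - closest_point K v)"

text \<open>
  The minima in the primal problem, the dual function and the augmented dual function are infima
  in \<^typ>\<open>ereal\<close>. For the primal problem the value is \<open>\<infinity>\<close> exactly if it is infeasible. Lemma
  \<open>attains_minimum\<close> below shows that the infima over \<open>U\<close> are attained.
\<close>

definition primal_value ::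
  "(real^'n \<Rightarrow> ereal) \<Rightarrow> (real^'n) set \<Rightarrow> real^'n^'m \<Rightarrow> real^'m \<Rightarrow> (real^'m) set \<Rightarrow> ereal" where
  "primal_value f U G g K = (INF u\<in>{u\<in>U. G *v u + g \<in> K}. f u)"

definition dual_fun ::
  "(real^'n \<Rightarrow> ereal) \<Rightarrow> (real^'n) set \<Rightarrow> real^'n^'m \<Rightarrow> real^'m \<Rightarrow> (real^'m) set \<Rightarrow> real^'m \<Rightarrow> ereal" where
  "dual_fun f U G g K x = (INF (u, s)\<in>U \<times> K. f u + ereal (inner x (G *v u + g - s)))"

definition aug_lagrangian ::
  "(real^'n \<Rightarrow> ereal) \<Rightarrow> real^'n^'m \<Rightarrow> real^'m \<Rightarrow> (real^'m) set \<Rightarrow> real \<Rightarrow> real^'n \<Rightarrow> real^'m \<Rightarrow> ereal" where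
  "aug_lagrangian f G g K \<mu> u x =
     f u + ereal (\<mu> / 2 * (dist_proj K (G *v u + g + (1 / \<mu>) *\<^sub>R x))\<^sup>2 - 1 / (2 * \<mu>) * (norm x)\<^sup>2)"

definition aug_dual ::
  "(real^'n \<Rightarrow> ereal) \<Rightarrow> (real^'n) set \<Rightarrow> real^'n^'m \<Rightarrow> real^'m \<Rightarrow> (real^'m) set \<Rightarrow> real \<Rightarrow> real^'m \<Rightarrow> ereal" where
  "aug_dual f U G g K \<mu> x = (INF u\<in>U. aug_lagrangian f G g K \<mu> u x)"

text \<open>
  The partial gradient of the augmented Lagrangian in its multiplier argument; lemma
  \<open>GDERIV_aug_lagrangian\<close> below proves that it is the gradient.
\<close>

definition grad_aug_lagrangian ::
  "real^'n^'m \<Rightarrow> real^'m \<Rightarrow> (real^'m) set \<Rightarrow> real \<Rightarrow> real^'n \<Rightarrow> real^'m \<Rightarrow> real^'m" where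
  "grad_aug_lagrangian G g K \<mu> u x = G *v u + g - closest_point K (G *v u + g + (1 / \<mu>) *\<^sub>R x)"

text \<open>
  First order inexact \<open>(\<delta>, L)\<close>-oracle for a concave function \<open>\<phi>\<close>: at each \<open>y\<close> it returns a value
  \<open>v y\<close> and a vector \<open>w y\<close> whose affine model majorizes \<open>\<phi>\<close> with error at most
  \<open>L / 2 * (norm (x - y))\<^sup>2 + \<delta>\<close>.
\<close>

definition inexact_oracle ::
  "real \<Rightarrow> real \<Rightarrow> ('a::real_inner \<Rightarrow> ereal) \<Rightarrow> ('a \<Rightarrow> ereal) \<Rightarrow> ('a \<Rightarrow> 'a) \<Rightarrow> bool" where
  "inexact_oracle \<delta> L \<phi> v w \<longleftrightarrow>
     (\<forall>x y. 0 \<le> v y + ereal (inner (w y) (x - y)) - \<phi> x \<and>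
            v y + ereal (inner (w y) (x - y)) - \<phi> x \<le> ereal (L / 2 * (norm (x - y))\<^sup>2 + \<delta>))"

lemma attains_minimum:
  fixes f :: "'a::euclidean_space \<Rightarrow> ereal" and q :: "'a \<Rightarrow> real"
  assumes f: "closed_fun f" and S: "compact S" "S \<noteq> {}" and q: "continuous_on UNIV q"
  shows "\<exists>u\<in>S. f u + ereal (q u) = (INF v\<in>S. f v + ereal (q v))"
proof -
  define h where "h u = f u + ereal (q u)" for u
  define m where "m = (INF v\<in>S. h v)"
  define A where "A c = {u\<in>S. h u \<le> ereal c}" for c
  have h_le: "h u \<le> ereal c \<longleftrightarrow> f u \<le> ereal (c - q u)" for u c
    unfolding h_def by (cases "f u") auto
  have A: "compact (A c)" for c
  proof -
    have "continuous_on UNIV (\<lambda>u. (u, c - q u))"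
      using q by (intro continuous_intros)
    hence "closed ((\<lambda>u. (u, c - q u)) -` ereal_epigraph f)"
      using f unfolding closed_fun_def by (intro closed_vimage)
    moreover have "A c = S \<inter> ((\<lambda>u. (u, c - q u)) -` ereal_epigraph f)"
      by (auto simp: A_def h_le ereal_epigraph_def)
    ultimately show ?thesis using S(1) by (simp add: compact_Int_closed)
  qed
  have "\<exists>u\<in>S. h u \<le> m"
  proof (cases "m = \<infinity>")
    case True
    with S(2) show ?thesis by auto
  next
    case False
    have ne: "A c \<noteq> {}" if c: "m < ereal c" for c
    proof -
      obtain v where "v \<in> S" "h v < ereal c"
        using c unfolding m_def by (auto simp: INF_less_iff)
      thus ?thesis by (auto simp: A_def)
    qed
    have mono: "A c \<subseteq> A c'" if "c \<le> c'" for c c'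
      using that by (auto simp: A_def intro: order_trans)
    have "(\<Inter>(A ` {c. m < ereal c})) \<noteq> {}"
    proof (rule compact_chain)
      fix T assume "T \<in> A ` {c. m < ereal c}"
      thus "compact T" using A by auto
    next
      show "{} \<notin> A ` {c. m < ereal c}" using ne by auto
    next
      fix T T' assume "T \<in> A ` {c. m < ereal c} \<and> T' \<in> A ` {c. m < ereal c}"
      then obtain c c' where "T = A c" "T' = A c'" by auto
      thus "T \<subseteq> T' \<or> T' \<subseteq> T" using mono linear by metis
    qed
    then obtain u where u: "u \<in> A c" if "m < ereal c" for c by auto
    obtain c0 where "m < ereal c0"
      using False by (metis ereal_dense2 less_ereal.simps(1) not_less_iff_gr_or_eq ereal_infty_less(1))
    hence "u \<in> S" using u by (auto simp: A_def)
    moreover have "h u \<le> m"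
    proof (rule ccontr)
      assume "\<not> h u \<le> m"
      then obtain c where "m < ereal c" "ereal c < h u"
        using ereal_dense2[of m "h u"] by (auto simp: not_le)
      with u[of c] show False by (auto simp: A_def)
    qed
    ultimately show ?thesis by blast
  qed
  then obtain u where "u \<in> S" "h u \<le> m" by blast
  moreover from \<open>u \<in> S\<close> have "m \<le> h u" unfolding m_def by (rule INF_lower)
  ultimately have "u \<in> S" "h u = m" by auto
  thus ?thesis by (auto simp: h_def m_def)
qed

lemma GDERIV_dist_proj_sq:
  fixes K :: "'a::euclidean_space set"
  assumes K: "closed K" "convex K" "K \<noteq> {}"
  shows "GDERIV (\<lambda>z. (dist_proj K z)\<^sup>2) z :> (2 *\<^sub>R (z - closest_point K z))"
proof -
  define p where "p = closest_point K"
  define D where "D z = (dist_proj K z)\<^sup>2" for z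
  define w where "w = 2 *\<^sub>R (z - p z)"
  have D: "D x = (norm (x - p x))\<^sup>2" for x by (simp add: D_def dist_proj_def p_def)
  have le: "D x \<le> (norm (x - p y))\<^sup>2" for x y
  proof -
    have "dist x (p x) \<le> dist x (p y)"
      unfolding p_def using K by (intro closest_point_le closest_point_in_set)
    thus ?thesis unfolding D dist_norm by (intro power_mono) auto
  qed
  have exp: "(norm (x - p v))\<^sup>2 = (norm (y - p v))\<^sup>2 + 2 * inner (y - p v) (x - y) + (norm (x - y))\<^sup>2"
    for x y v
    by (simp add: power2_norm_eq_inner inner_diff inner_commute algebra_simps)
  have up: "D y - D z - inner (y - z) w \<le> (norm (y - z))\<^sup>2" for y
    using le[of y z] exp[of y z z] by (simp add: w_def D inner_commute)
  have lo: "- (4 * (norm (y - z))\<^sup>2) \<le> D y - D z - inner (y - z) w" for y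
  proof -
    have "D z \<le> D y + 2 * inner (y - p y) (z - y) + (norm (z - y))\<^sup>2"
      using le[of z y] exp[of z y y] by (simp add: D)
    moreover have "2 * inner (y - p y) (z - y) = - inner (y - z) w - 2 * (norm (y - z))\<^sup>2
                      - 2 * inner (p z - p y) (y - z)"
      by (simp add: w_def power2_norm_eq_inner inner_diff inner_commute algebra_simps)
    moreover have "- inner (p z - p y) (y - z) \<le> (norm (y - z))\<^sup>2"
    proof -
      have "norm (p z - p y) \<le> norm (y - z)"
        using closest_point_lipschitz[OF K(2) K(1) K(3), of z y]
        by (simp add: p_def dist_norm norm_minus_commute)
      moreover have "\<bar>inner (p z - p y) (y - z)\<bar> \<le> norm (p z - p y) * norm (y - z)"
        by (rule Cauchy_Schwarz_ineq2)
      ultimately show ?thesis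
        using mult_right_mono[of "norm (p z - p y)" "norm (y - z)" "norm (y - z)"]
        by (simp add: power2_eq_square)
    qed
    moreover have "0 \<le> (norm (y - z))\<^sup>2" by simp
    ultimately show ?thesis
      unfolding norm_minus_commute[of z y] by linarith
  qed
  have "(D has_derivative (\<lambda>h. inner h w)) (at z)"
    unfolding has_derivative_at_alt
  proof (intro conjI allI impI)
    show "bounded_linear (\<lambda>h. inner h w)" by (rule bounded_linear_inner_left)
    fix e :: real assume e: "0 < e"
    show "\<exists>d>0. \<forall>y. norm (y - z) < d \<longrightarrow> norm (D y - D z - inner (y - z) w) \<le> e * norm (y - z)"
    proof (intro exI[of _ "e / 4"] conjI allI impI)
      fix y assume y: "norm (y - z) < e / 4"
      have "norm (D y - D z - inner (y - z) w) \<le> (4 * norm (y - z)) * norm (y - z)"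
        using up[of y] lo[of y] zero_le_power2[of "norm (y - z)"] by (simp add: power2_eq_square abs_le_iff)
      also have "\<dots> \<le> e * norm (y - z)"
        using y by (intro mult_right_mono) auto
      finally show "norm (D y - D z - inner (y - z) w) \<le> e * norm (y - z)" .
    qed (use e in auto)
  qed
  thus ?thesis by (simp add: gderiv_def D_def[abs_def] w_def p_def)
qed

lemma GDERIV_aug_lagrangian:
  fixes f :: "real^'n \<Rightarrow> ereal" and G :: "real^'n^'m"
  assumes K: "closed K" "convex K" "K \<noteq> {}" and \<mu>: "\<mu> > 0"
    and fu: "\<bar>f u\<bar> \<noteq> \<infinity>"
  shows "GDERIV (\<lambda>x. real_of_ereal (aug_lagrangian f G g K \<mu> u x)) x
           :> (grad_aug_lagrangian G g K \<mu> u x)"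
proof -
  define z where "z x = G *v u + g + (1 / \<mu>) *\<^sub>R x" for x
  obtain r where r: "f u = ereal r" using fu by (cases "f u") auto
  have "(z has_derivative (\<lambda>h. (1 / \<mu>) *\<^sub>R h)) (at x)"
    unfolding z_def by (auto intro!: derivative_eq_intros)
  from has_derivative_compose[OF this GDERIV_dist_proj_sq[OF K, unfolded gderiv_def]]
  have 1: "((\<lambda>x. (dist_proj K (z x))\<^sup>2) has_derivative
          (\<lambda>h. inner ((1 / \<mu>) *\<^sub>R h) (2 *\<^sub>R (z x - closest_point K (z x))))) (at x)" .
  have 2: "((\<lambda>x. (norm x)\<^sup>2) has_derivative (\<lambda>h. 2 * inner x h)) (at x)"
    unfolding power2_norm_eq_inner
    by (auto intro!: derivative_eq_intros simp: inner_commute)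
  have "((\<lambda>x. r + (\<mu> / 2 * (dist_proj K (z x))\<^sup>2 - 1 / (2 * \<mu>) * (norm x)\<^sup>2)) has_derivative
          (\<lambda>h. 0 + (\<mu> / 2 * inner ((1 / \<mu>) *\<^sub>R h) (2 *\<^sub>R (z x - closest_point K (z x)))
                - 1 / (2 * \<mu>) * (2 * inner x h)))) (at x)"
    by (intro has_derivative_add has_derivative_const has_derivative_diff has_derivative_mult_right 1 2)
  moreover have "(\<lambda>h. 0 + (\<mu> / 2 * inner ((1 / \<mu>) *\<^sub>R h) (2 *\<^sub>R (z x - closest_point K (z x)))
                - 1 / (2 * \<mu>) * (2 * inner x h))) = (\<lambda>h. inner h (grad_aug_lagrangian G g K \<mu> u x))"
    using \<mu> by (auto simp: fun_eq_iff grad_aug_lagrangian_def z_def inner_diff_right inner_add_right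
        inner_commute field_simps)
  ultimately show ?thesis
    by (simp add: gderiv_def aug_lagrangian_def r z_def)
qed

end

theory Submission
  imports Defs
begin

text \<open>
  Minimizing over the slack variable \<open>s \<in> K\<close> writes the augmented Lagrangian as the minimum of
  \<open>f u + \<langle>x, r\<rangle> + \<mu> / 2 * \<parallel>r\<parallel>\<^sup>2\<close> with the residual \<open>r = G u + g - s\<close>, and its gradient
  in \<open>x\<close> is the minimizing residual. For fixed \<open>(u, s)\<close> this is affine in \<open>x\<close>, which gives the lower
  bound. For the upper bound, the function is jointly convex in \<open>(u, s)\<close> and strongly convex in \<open>r\<close>;
  comparing a \<open>\<delta>\<close>-minimizer \<open>(u\<^sub>y, s\<^sub>y)\<close> for \<open>y\<close> with its midpoint to an arbitrary \<open>(u, s)\<close> shows that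
  the value at \<open>(u, s)\<close> exceeds that at \<open>(u\<^sub>y, s\<^sub>y)\<close> by at least \<open>\<mu> / 4 * \<parallel>r - r\<^sub>y\<parallel>\<^sup>2 - 2 * \<delta>\<close>.
  The quadratic term absorbs \<open>\<langle>x - y, r - r\<^sub>y\<rangle>\<close> at the cost of \<open>\<parallel>x - y\<parallel>\<^sup>2 / \<mu>\<close>.
\<close>

lemma convex_fun_imp_convex_on:
  assumes f: "convex_fun f" and S: "convex S" and fin: "\<And>u. u \<in> S \<Longrightarrow> \<bar>f u\<bar> \<noteq> \<infinity>"
  shows "convex_on S (\<lambda>u. real_of_ereal (f u))"
proof (rule convex_onI)
  fix t :: real and u v assume t: "0 < t" "t < 1" and uv: "u \<in> S" "v \<in> S"
  define w where "w = (1 - t) *\<^sub>R u + t *\<^sub>R v"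
  have w: "w \<in> S" using S t uv by (auto simp: w_def convex_alt)
  have real: "f z = ereal (real_of_ereal (f z))" if "z \<in> S" for z
    using fin[OF that] by (simp add: ereal_real)
  have "(z, real_of_ereal (f z)) \<in> ereal_epigraph f" if "z \<in> S" for z
    using real[OF that] by (simp add: ereal_epigraph_def)
  from this[OF uv(1)] this[OF uv(2)]
  have "(1 - t) *\<^sub>R (u, real_of_ereal (f u)) + t *\<^sub>R (v, real_of_ereal (f v)) \<in> ereal_epigraph f"
    using f t unfolding convex_fun_def convex_alt by (meson less_imp_le)
  hence "f w \<le> ereal ((1 - t) * real_of_ereal (f u) + t * real_of_ereal (f v))"
    by (simp add: ereal_epigraph_def w_def)
  thus "real_of_ereal (f ((1 - t) *\<^sub>R u + t *\<^sub>R v))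
          \<le> (1 - t) * real_of_ereal (f u) + t * real_of_ereal (f v)"
    using real[OF w] unfolding w_def by (metis ereal_less_eq(3))
qed (rule S)

text \<open>The multiplier-dependent part of the Lagrangian with the residual \<open>r\<close> kept
  as a free variable: linear in \<open>x\<close>, and strongly convex in \<open>r\<close> with
  modulus \<open>\<mu>\<close>.\<close>

definition penalty :: "real \<Rightarrow> 'a::real_inner \<Rightarrow> 'a \<Rightarrow> real" where
  "penalty \<mu> x r = inner x r + \<mu> / 2 * (norm r)\<^sup>2"

lemma penalty_shift: "penalty \<mu> x r = penalty \<mu> y r + inner r (x - y)"
  by (simp add: penalty_def inner_diff_right inner_commute)

text \<open>Parallelogram law: the midpoint gain of strong convexity is exact for a
  quadratic.\<close>

lemma penalty_midpoint:
  "penalty \<mu> y (midpoint a b) = (penalty \<mu> y a + penalty \<mu> y b) / 2 - \<mu> / 8 * (norm (a - b))\<^sup>2"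
proof -
  have "(norm (midpoint a b))\<^sup>2 = ((norm a)\<^sup>2 + (norm b)\<^sup>2) / 2 - (norm (a - b))\<^sup>2 / 4"
    by (simp add: midpoint_def power2_norm_eq_inner inner_add inner_diff inner_commute field_simps)
  moreover have "inner y (midpoint a b) = (inner y a + inner y b) / 2"
    by (simp add: midpoint_def inner_add_right)
  ultimately show ?thesis
    by (simp only: penalty_def) (simp add: algebra_simps add_divide_distrib)
qed

text \<open>Shows that minimizing over the slack is projecting
  \<open>G *v u + g + (1 / \<mu>) *\<^sub>R x\<close> onto \<open>K\<close>.\<close>

lemma penalty_complete_square:
  assumes "\<mu> > 0"
  shows "penalty \<mu> x r = \<mu> / 2 * (norm (r + (1 / \<mu>) *\<^sub>R x))\<^sup>2 - 1 / (2 * \<mu>) * (norm x)\<^sup>2"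
  using assms
  by (simp add: penalty_def power2_norm_eq_inner inner_add inner_commute field_simps)

text \<open>Young's inequality, with the weight \<open>\<mu> / 4\<close> that the doubled midpoint
  gain provides.\<close>

lemma young_lower_bound:
  fixes a b :: "'a::real_inner"
  assumes "\<mu> > 0"
  shows "- ((norm b)\<^sup>2 / \<mu>) \<le> inner a b + \<mu> / 4 * (norm a)\<^sup>2"
proof -
  have "inner a b + \<mu> / 4 * (norm a)\<^sup>2 + (norm b)\<^sup>2 / \<mu> = \<mu> / 4 * (norm (a + (2 / \<mu>) *\<^sub>R b))\<^sup>2"
    using assms by (simp add: power2_norm_eq_inner inner_add inner_commute field_simps)
  moreover have "\<dots> \<ge> 0" using assms by simp
  ultimately show ?thesis by linarith
qed

lemma aug_lagrangian_eq_penalty: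
  assumes "\<mu> > 0"
  shows "aug_lagrangian f G g K \<mu> u x = f u + ereal (penalty \<mu> x (grad_aug_lagrangian G g K \<mu> u x))"
  unfolding aug_lagrangian_def penalty_complete_square[OF assms] dist_proj_def grad_aug_lagrangian_def
  by (simp add: algebra_simps)

lemma aug_lagrangian_le_penalty:
  assumes "\<mu> > 0" and K: "closed K" and s: "s \<in> K"
  shows "aug_lagrangian f G g K \<mu> u x \<le> f u + ereal (penalty \<mu> x (G *v u + g - s))"
proof -
  define z where "z = G *v u + g + (1 / \<mu>) *\<^sub>R x"
  have "norm (z - closest_point K z) \<le> norm (z - s)"
    using closest_point_le[OF K s, of z] by (simp add: dist_norm)
  hence "(norm (z - closest_point K z))\<^sup>2 \<le> (norm (z - s))\<^sup>2" by simp
  hence "\<mu> / 2 * (dist_proj K z)\<^sup>2 \<le> \<mu> / 2 * (norm (z - s))\<^sup>2"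
    using assms(1) unfolding dist_proj_def by (intro mult_left_mono) auto
  moreover have "z - s = G *v u + g - s + (1 / \<mu>) *\<^sub>R x" by (simp add: z_def)
  ultimately show ?thesis
    unfolding aug_lagrangian_def penalty_complete_square[OF assms(1)] z_def[symmetric]
    by (intro add_left_mono) simp
qed

text \<open>The slack optimal at \<open>y\<close> is still feasible at \<open>x\<close>, and with it
  fixed the penalty is affine in the multiplier with the gradient at \<open>y\<close> as
  slope.\<close>

lemma aug_lagrangian_le_linearization:
  assumes "\<mu> > 0" and K: "closed K" "K \<noteq> {}"
  shows "aug_lagrangian f G g K \<mu> u x
           \<le> aug_lagrangian f G g K \<mu> u y + ereal (inner (grad_aug_lagrangian G g K \<mu> u y) (x - y))"
proof -
  have "closest_point K (G *v u + g + (1 / \<mu>) *\<^sub>R y) \<in> K"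
    using K by (rule closest_point_in_set)
  from aug_lagrangian_le_penalty[OF assms(1) K(1) this, of f G g u x] show ?thesis
    unfolding aug_lagrangian_eq_penalty[OF assms(1), of f G g K u y]
      grad_aug_lagrangian_def[symmetric] penalty_shift[of \<mu> x _ y]
    by (simp add: add.assoc)
qed

lemma aug_lagrangian_ge_linearization:
  fixes f :: "real^'n \<Rightarrow> ereal" and G :: "real^'n^'m"
  assumes \<mu>: "\<mu> > 0" and K: "closed K" "convex K" "K \<noteq> {}"
    and f: "convex_fun f" and U: "convex U" and fin: "\<And>u. u \<in> U \<Longrightarrow> \<bar>f u\<bar> \<noteq> \<infinity>"
    and u: "u \<in> U" and v: "v \<in> U"
    and v_min: "\<And>w. w \<in> U \<Longrightarrow> aug_lagrangian f G g K \<mu> v y \<le> aug_lagrangian f G g K \<mu> w y + ereal \<delta>"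
  shows "aug_lagrangian f G g K \<mu> v y + ereal (inner (grad_aug_lagrangian G g K \<mu> v y) (x - y))
           \<le> aug_lagrangian f G g K \<mu> u x + ereal ((norm (x - y))\<^sup>2 / \<mu> + 2 * \<delta>)"
proof -
  define F where "F u = real_of_ereal (f u)" for u
  have F: "f w = ereal (F w)" if "w \<in> U" for w
    using fin[OF that] by (simp add: F_def ereal_real)
  \<comment> \<open>Each slack is optimal for its own multiplier: \<open>s\<close> for
    \<open>x\<close>, \<open>t\<close> for \<open>y\<close>. Thus \<open>a\<close> and
    \<open>b\<close> are the residuals at which the two Lagrangians equal their penalties.\<close>
  define s where "s = closest_point K (G *v u + g + (1 / \<mu>) *\<^sub>R x)"
  define t where "t = closest_point K (G *v v + g + (1 / \<mu>) *\<^sub>R y)"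
  define a where "a = grad_aug_lagrangian G g K \<mu> u x"
  define b where "b = grad_aug_lagrangian G g K \<mu> v y"
  define w where "w = midpoint u v"
  have "s \<in> K" "t \<in> K" using K unfolding s_def t_def by (auto intro: closest_point_in_set)
  hence st: "midpoint s t \<in> K"
    using K(2) closed_segment_subset midpoint_in_closed_segment by blast
  have w: "w \<in> U"
    unfolding w_def using U u v closed_segment_subset midpoint_in_closed_segment by blast
  have "G *v w = midpoint (G *v u) (G *v v)"
    by (simp add: w_def midpoint_def matrix_vector_mult_scaleR matrix_vector_right_distrib)
  hence res: "G *v w + g - midpoint s t = midpoint a b"
    by (simp add: midpoint_def a_def b_def s_def t_def grad_aug_lagrangian_def vec_eq_iff field_simps)
  have "F w \<le> (F u + F v) / 2"
    using convex_onD[OF convex_fun_imp_convex_on[OF f U fin], of "1/2" u v] u v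
    by (simp add: F_def w_def midpoint_def scaleR_add_right)
  \<comment> \<open>The averaged slack is feasible for \<open>w\<close> but perhaps not optimal, so
    its penalty bounds the Lagrangian at \<open>w\<close> from above.\<close>
  moreover have "aug_lagrangian f G g K \<mu> v y \<le> f w + ereal (penalty \<mu> y (midpoint a b)) + ereal \<delta>"
    using v_min[OF w] aug_lagrangian_le_penalty[OF \<mu> K(1) st, of f G g w y, unfolded res]
    by (meson add_right_mono order_trans)
  hence "F v + penalty \<mu> y b \<le> F w + penalty \<mu> y (midpoint a b) + \<delta>"
    using v w by (simp add: aug_lagrangian_eq_penalty[OF \<mu>] F b_def)
  \<comment> \<open>Clearing the factor 1/2 of the midpoint doubles both \<open>\<mu> / 8\<close>
    and \<open>\<delta>\<close>.\<close>
  ultimately have "F v + penalty \<mu> y b + \<mu> / 4 * (norm (a - b))\<^sup>2 \<le> F u + penalty \<mu> y a + 2 * \<delta>"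
    unfolding penalty_midpoint by (simp add: field_simps)
  moreover have "- ((norm (x - y))\<^sup>2 / \<mu>) \<le> inner a (x - y) - inner b (x - y) + \<mu> / 4 * (norm (a - b))\<^sup>2"
    using young_lower_bound[OF \<mu>, of "x - y" "a - b"] by (simp add: inner_diff_left)
  ultimately have "F v + penalty \<mu> y b + inner b (x - y)
      \<le> F u + penalty \<mu> x a + ((norm (x - y))\<^sup>2 / \<mu> + 2 * \<delta>)"
    unfolding penalty_shift[of \<mu> x a y] by linarith
  thus ?thesis
    using u v by (simp add: aug_lagrangian_eq_penalty[OF \<mu>] F a_def b_def)
qed

theorem theorem3p2:
  fixes f :: "real^'n \<Rightarrow> ereal" and U :: "(real^'n) set"
    and G :: "real^'n^'m" and g :: "real^'m" and K :: "(real^'m) set"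
    and x_star :: "real^'m" and \<mu> \<delta> Ld :: real
    and u\<^sub>\<mu> :: "real^'m \<Rightarrow> real^'n"
  assumes "proper_fun f" and "closed_fun f" and "convex_fun f"
    and "U \<subseteq> edom f" and "U \<noteq> {}" and "closed U" and "convex U" and "bounded U"
    and "K \<noteq> {}" and "closed K" and "convex K" and "cone K"
    and "x_star \<in> polar_cone K"
    and "primal_value f U G g K = dual_fun f U G g K x_star"
    and "\<mu> > 0" and "\<delta> > 0" and "Ld = 1 / \<mu>"
    and "\<And>y. u\<^sub>\<mu> y \<in> U"
    and "\<And>y. 0 \<le> aug_lagrangian f G g K \<mu> (u\<^sub>\<mu> y) y - aug_dual f U G g K \<mu> y"
    and "\<And>y. aug_lagrangian f G g K \<mu> (u\<^sub>\<mu> y) y - aug_dual f U G g K \<mu> y \<le> ereal \<delta>"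
  shows "(\<forall>x y.
            0 \<le> aug_lagrangian f G g K \<mu> (u\<^sub>\<mu> y) y
                 + ereal (inner (grad_aug_lagrangian G g K \<mu> (u\<^sub>\<mu> y) y) (x - y))
                 - aug_dual f U G g K \<mu> x \<and>
            aug_lagrangian f G g K \<mu> (u\<^sub>\<mu> y) y
                 + ereal (inner (grad_aug_lagrangian G g K \<mu> (u\<^sub>\<mu> y) y) (x - y))
                 - aug_dual f U G g K \<mu> x
              \<le> ereal (2 * Ld / 2 * (norm (x - y))\<^sup>2 + 3 * \<delta>))
       \<and> inexact_oracle (3 * \<delta>) (2 * Ld) (aug_dual f U G g K \<mu>)
            (\<lambda>y. aug_lagrangian f G g K \<mu> (u\<^sub>\<mu> y) y)
            (\<lambda>y. grad_aug_lagrangian G g K \<mu> (u\<^sub>\<mu> y) y)"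
proof -
  let ?L = "aug_lagrangian f G g K \<mu>" and ?d = "aug_dual f U G g K \<mu>"
    and ?D = "grad_aug_lagrangian G g K \<mu>"
  have fin: "\<bar>f u\<bar> \<noteq> \<infinity>" if "u \<in> U" for u
    using \<open>proper_fun f\<close> \<open>U \<subseteq> edom f\<close> that by (auto simp: proper_fun_def edom_def)
  have L_fin: "\<bar>?L u x\<bar> \<noteq> \<infinity>" if "u \<in> U" for u x
    using fin[OF that] by (cases "f u") (auto simp: aug_lagrangian_def)
  \<comment> \<open>An infinite dual value would make the gap to the finite Lagrangian value
    infinite, outside the range from 0 to \<open>\<delta>\<close>.\<close>
  have d_fin: "\<bar>?d y\<bar> \<noteq> \<infinity>" for y
    using L_fin[OF assms(18)[of y], of y] assms(19)[of y] assms(20)[of y]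
    by (cases "?L (u\<^sub>\<mu> y) y"; cases "?d y") auto
  have d_le: "?d x \<le> ?L u x" if "u \<in> U" for u x
    using that unfolding aug_dual_def by (rule INF_lower)
  have v_min: "?L (u\<^sub>\<mu> y) y \<le> ?L w y + ereal \<delta>" if "w \<in> U" for w y
    using assms(20)[of y] d_le[OF that, of y] d_fin[of y] L_fin[OF that, of y]
      L_fin[OF assms(18)[of y], of y]
    by (cases "?L (u\<^sub>\<mu> y) y"; cases "?d y"; cases "?L w y") auto
  have "0 \<le> ?L (u\<^sub>\<mu> y) y + ereal (inner (?D (u\<^sub>\<mu> y) y) (x - y)) - ?d x \<and>
        ?L (u\<^sub>\<mu> y) y + ereal (inner (?D (u\<^sub>\<mu> y) y) (x - y)) - ?d x
          \<le> ereal (2 * Ld / 2 * (norm (x - y))\<^sup>2 + 3 * \<delta>)" for x y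
  proof -
    define M where "M = ?L (u\<^sub>\<mu> y) y + ereal (inner (?D (u\<^sub>\<mu> y) y) (x - y))"
    define c where "c = (norm (x - y))\<^sup>2 / \<mu> + 2 * \<delta>"
    have lower: "?d x \<le> M"
      using d_le[OF assms(18), of x y]
        aug_lagrangian_le_linearization[OF \<open>\<mu> > 0\<close> \<open>closed K\<close> \<open>K \<noteq> {}\<close>, of f G g "u\<^sub>\<mu> y" x y]
      unfolding M_def by (rule order_trans)
    have "M \<le> ?L u x + ereal c" if "u \<in> U" for u
      unfolding M_def c_def using assms fin that v_min
      by (intro aug_lagrangian_ge_linearization) auto
    \<comment> \<open>The finite \<open>c\<close> moves to the left, leaving a bound independent of
      \<open>u\<close> to pass to the infimum.\<close>
    hence "M - ereal c \<le> ?d x"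
      unfolding aug_dual_def by (intro INF_greatest) (simp add: ereal_minus_le)
    hence upper: "M \<le> ?d x + ereal c" by (simp add: ereal_minus_le)
    \<comment> \<open>The quadratic terms agree, as \<open>Ld = 1 / \<mu>\<close>; the rest is
      \<open>2 * \<delta> \<le> 3 * \<delta>\<close>.\<close>
    have "c \<le> 2 * Ld / 2 * (norm (x - y))\<^sup>2 + 3 * \<delta>"
      using \<open>\<delta> > 0\<close> \<open>Ld = 1 / \<mu>\<close> by (simp add: c_def)
    with lower upper d_fin[of x] show ?thesis
      unfolding M_def[symmetric] by (cases M; cases "?d x") auto
  qed
  thus ?thesis unfolding inexact_oracle_def by blast
qed

end
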